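(* Let $M=\{(a,0),(0,a):a>0\}\cup\{(b,c):1\le b\le c\}$ (with $a,b,c$ integers), and let $P_M(t)=\sum_{n\ge0}p_{M,n}t^n$, where $p_{M,n}$ is the number of Catalan $M$-paths from $(0,0)$ to $(n,n)$. Then, as formal power series, $$P_M(t)=\frac{3t^2-t-1+\sqrt{1-14t+35t^2-30t^3+9t^4}}{4t(3t-2)}.$$
   Context: An $M$-path from $(0,0)$ to $(n,m)$ is a finite (possibly empty) sequence of steps in $M$ summing to $(n,m)$; its nodes are $(0,0)$ and the points reached after each step. The path is Catalan if every node $(x,y)$ satisfies $x<y+1$, i.e. $x\le y$. The square root is the power series square root with constant term $1$. *)

theory Defs
  imports Complex_Main "HOL-Library.Product_Plus"
    "HOL-Computational_Algebra.Formal_Power_Series"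
begin

definition is_path :: "(int \<times> int) set \<Rightarrow> int \<times> int \<Rightarrow> (int \<times> int) list \<Rightarrow> bool" where
  "is_path M p ss \<longleftrightarrow> set ss \<subseteq> M \<and> sum_list ss = p"

text \<open>The prefix of length \<open>0\<close> contributes the starting node \<open>(0, 0)\<close>.\<close>

definition nodes :: "(int \<times> int) list \<Rightarrow> (int \<times> int) set" where
  "nodes ss = {sum_list (take k ss) | k. k \<le> length ss}"

definition catalan :: "(int \<times> int) list \<Rightarrow> bool" where
  "catalan ss \<longleftrightarrow> (\<forall>(x, y) \<in> nodes ss. x < y + 1)"

definition catalan_paths :: "(int \<times> int) set \<Rightarrow> nat \<Rightarrow> (int \<times> int) list set" where
  "catalan_paths M n = {ss. is_path M (int n, int n) ss \<and> catalan ss}"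

text \<open>
  For a general \<open>M\<close> the set counted here may be infinite, and \<open>card\<close> is then \<open>0\<close>.  It is
  finite for every \<open>M\<close> whose steps are nonzero with nonnegative coordinates,
  in particular for \<open>step_set\<close> below.
\<close>

definition catalan_gf :: "(int \<times> int) set \<Rightarrow> real fps" where
  "catalan_gf M = Abs_fps (\<lambda>n. of_nat (card (catalan_paths M n)))"

definition step_set :: "(int \<times> int) set" where
  "step_set = {(a, 0) | a. a > 0} \<union> {(0, a) | a. a > 0} \<union> {(b, c) | b c. 1 \<le> b \<and> b \<le> c}"

text \<open>
  \<open>root 2\<close> picks the real square root of the constant coefficient, so a series with constant
  coefficient \<open>1\<close> is sent to its square root with constant coefficient \<open>1\<close>.
\<close>

abbreviation fps_sqrt :: "real fps \<Rightarrow> real fps" where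
  "fps_sqrt f \<equiv> fps_radical root 2 f"

lemma fps_sqrt_spec:
  assumes "fps_nth f 0 = 1"
  shows "fps_sqrt f ^ 2 = f" and "fps_nth (fps_sqrt f) 0 = 1"
  using assms power_radical[of f root 1] by (simp_all add: numeral_2_eq_2)

text \<open>
  Division of formal power series by \<open>g\<close> of subdegree \<open>d\<close> drops the coefficients of the dividend
  below \<open>d\<close>.  A quotient by \<open>4 * fps_X * (3 * fps_X - 2)\<close>, where \<open>d = 1\<close>, is therefore exact
  precisely when the dividend has constant coefficient \<open>0\<close>.  The following lemma records this for
  the dividend \<open>3 t\<^sup>2 - t - 1 + s\<close>, where \<open>s\<close> is a square root with constant coefficient \<open>1\<close>.
\<close>

lemma exact_division:
  fixes s :: "real fps"
  assumes "fps_nth s 0 = 1"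
  defines "num \<equiv> 3 * fps_X ^ 2 - fps_X - 1 + s"
  defines "den \<equiv> 4 * fps_X * (3 * fps_X - 2)"
  shows "num / den * den = num"
proof -
  have "fps_nth den 1 = - 8"
    by (simp add: den_def fps_numeral_fps_const mult.assoc)
  then have den0: "den \<noteq> 0" and sd: "subdegree den \<le> 1"
    by (auto intro: subdegree_leI)
  have num0: "fps_nth num 0 = 0"
    using assms(1) by (simp add: num_def)
  have "den dvd num"
  proof (cases "num = 0")
    case False
    with num0 have "subdegree num \<ge> 1"
      by (intro subdegree_geI) auto
    with den0 False sd show ?thesis
      by (simp add: fps_dvd_iff)
  qed simp
  then show ?thesis by simp
qed

end

theory Submission
  imports Defs
begin

text \<open>
  Let \<open>g\<^sub>h\<close> be the generating function in \<open>t\<close> of the Catalan paths ending at \<open>(x, x + h)\<close>,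
  with \<open>x\<close> marked by \<open>t\<close>, and let \<open>S\<^sub>h = g\<^sub>0 + \<dots> + g\<^bsub>h-1\<^esub>\<close>.  Removing the last
  step of a path and eliminating the contribution of the horizontal steps yields a linear
  recurrence of order two in \<open>h\<close>,
  \<open>p S\<^bsub>h+2\<^esub> - q S\<^bsub>h+1\<^esub> + 2(1 - t) S\<^sub>h = -(1 - t)[h = 0]\<close>, where
  \<open>p = t(2 - 3t)\<close> and \<open>q = 1 + t - 3t\<^sup>2\<close>.
  Let \<open>V\<close> be the root with \<open>V(0) = 0\<close> of \<open>2V\<^sup>2 - qV + (1-t)p = 0\<close>, and \<open>U = V/(1-t)\<close>.
  The recurrence factors into \<open>T\<^sub>h = U T\<^bsub>h+1\<^esub>\<close> for \<open>h \<ge> 1\<close> and \<open>T\<^sub>0 = U T\<^sub>1 + V\<close>,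
  where \<open>T\<^sub>h = p S\<^bsub>h+1\<^esub> - 2V S\<^sub>h\<close>.  As \<open>U\<close> is divisible by \<open>t\<close>, the series \<open>T\<^sub>1\<close> is
  divisible by every power of \<open>t\<close> and vanishes.  Hence \<open>p g\<^sub>0 = T\<^sub>0 = V\<close>.
\<close>

section \<open>Appending a step to a path\<close>

lemma nodes_snoc: "nodes (ss @ [s]) = insert (sum_list (ss @ [s])) (nodes ss)"
proof -
  have "nodes xs = (\<lambda>k. sum_list (take k xs)) ` {..length xs}" for xs
    by (auto simp: nodes_def)
  then show ?thesis
    by (simp add: atMost_Suc)
qed

lemma catalan_Nil: "catalan []"
  by (simp add: catalan_def nodes_def zero_prod_def)

lemma catalan_snoc:
  "catalan (ss @ [s]) \<longleftrightarrow>
    catalan ss \<and> fst (sum_list (ss @ [s])) \<le> snd (sum_list (ss @ [s]))"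
  unfolding catalan_def nodes_snoc by (auto simp: case_prod_beta)

lemma sum_list_in_nodes: "sum_list ss \<in> nodes ss"
  unfolding nodes_def by (auto intro!: exI[of _ "length ss"])

lemma step_set_iff:
  "(a, b) \<in> step_set \<longleftrightarrow> a > 0 \<and> b = 0 \<or> a = 0 \<and> b > 0 \<or> 1 \<le> a \<and> a \<le> b"
  by (auto simp: step_set_def)

lemma sum_list_steps_nonneg:
  assumes "set ss \<subseteq> step_set"
  shows "0 \<le> fst (sum_list ss)" "0 \<le> snd (sum_list ss)"
  using assms by (induction ss) (auto simp: step_set_iff)

section \<open>Decomposition by the last step\<close>

definition paths_to :: "nat \<Rightarrow> nat \<Rightarrow> (int \<times> int) list set" where
  "paths_to x y = {ss. is_path step_set (int x, int y) ss \<and> catalan ss}"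

definition preds :: "nat \<Rightarrow> nat \<Rightarrow> (nat \<times> nat) set" where
  "preds x y = {(i, j). i \<le> x \<and> j \<le> y \<and> (int x - int i, int y - int j) \<in> step_set}"

lemma finite_preds: "finite (preds x y)"
  by (rule finite_subset[of _ "{..x} \<times> {..y}"]) (auto simp: preds_def)

lemma preds_less: "(i, j) \<in> preds x y \<Longrightarrow> i + j < x + y"
  by (auto simp: preds_def step_set_iff)

lemma paths_to_empty: "y < x \<Longrightarrow> paths_to x y = {}"
  using sum_list_in_nodes by (fastforce simp: paths_to_def is_path_def catalan_def)

text \<open>A prefix of a Catalan path is Catalan, and steps have nonnegative coordinates, so the
  point before the last step is a pair of naturals. Conversely, \<open>x \<le> y\<close> keeps the
  extended path Catalan.\<close>

lemma paths_to_rec: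
  assumes "x \<le> y"
  shows "paths_to x y = (if x = 0 \<and> y = 0 then {[]} else {}) \<union>
    (\<Union>(i, j) \<in> preds x y. (\<lambda>ss. ss @ [(int x - int i, int y - int j)]) ` paths_to i j)"
    (is "_ = ?E \<union> ?R")
proof (intro equalityI subsetI)
  fix ss assume ss: "ss \<in> paths_to x y"
  show "ss \<in> ?E \<union> ?R"
  proof (cases ss rule: rev_cases)
    case Nil
    with ss show ?thesis
      by (simp add: paths_to_def is_path_def zero_prod_def)
  next
    case (snoc rs s)
    obtain a b where s: "s = (a, b)" by fastforce
    obtain c d where cd: "sum_list rs = (c, d)" by fastforce
    have rs: "set rs \<subseteq> step_set" "catalan rs" and st: "(a, b) \<in> step_set"
      and sums: "c + a = int x" "d + b = int y"
      using ss by (auto simp: snoc s cd paths_to_def is_path_def catalan_snoc)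
    define i j where "i = nat c" and "j = nat d"
    have ij: "c = int i" "d = int j"
      using sum_list_steps_nonneg[OF rs(1)] by (auto simp: i_def j_def cd)
    have ab: "a = int x - int i" "b = int y - int j"
      using sums ij by auto
    have "rs \<in> paths_to i j"
      using rs cd ij by (simp add: paths_to_def is_path_def)
    moreover have "(i, j) \<in> preds x y"
      using st ab by (auto simp: preds_def step_set_iff)
    ultimately show ?thesis
      using snoc s ab by force
  qed
next
  fix ss assume "ss \<in> ?E \<union> ?R"
  then show "ss \<in> paths_to x y"
    using assms
    by (auto simp: paths_to_def is_path_def catalan_snoc catalan_Nil preds_def zero_prod_def
        split: if_splits)
qed

lemma finite_paths_to: "finite (paths_to x y)"
proof (induction "x + y" arbitrary: x y rule: less_induct)
  case less
  show ?case
  proof (cases "x \<le> y")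
    case True
    have "finite (paths_to i j)" if "(i, j) \<in> preds x y" for i j
      using less[OF preds_less[OF that]] .
    then show ?thesis
      unfolding paths_to_rec[OF True] by (auto simp: finite_preds)
  qed (simp add: paths_to_empty)
qed

text \<open>The union is disjoint because the last step determines \<open>(i, j)\<close>, and
  appending a fixed step is injective.\<close>

lemma card_paths_to_rec:
  assumes "x \<le> y"
  shows "card (paths_to x y) =
    of_bool (x = 0 \<and> y = 0) + (\<Sum>(i, j) \<in> preds x y. card (paths_to i j))"
proof -
  define R where "R = (\<lambda>(i, j). (\<lambda>ss. ss @ [(int x - int i, int y - int j)]) ` paths_to i j)"
  have "paths_to x y = (if x = 0 \<and> y = 0 then {[]} else {}) \<union> (\<Union>z \<in> preds x y. R z)"
    using paths_to_rec[OF assms] by (simp add: R_def)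
  moreover have "finite (\<Union>z \<in> preds x y. R z)"
    using finite_preds finite_paths_to by (auto simp: R_def)
  ultimately have "card (paths_to x y) =
      of_bool (x = 0 \<and> y = 0) + card (\<Union>z \<in> preds x y. R z)"
    by (auto simp: R_def card_insert_if)
  also have "card (\<Union>z \<in> preds x y. R z) = (\<Sum>z \<in> preds x y. card (R z))"
    by (rule card_UN_disjoint) (auto simp: finite_preds finite_paths_to R_def)
  also have "\<dots> = (\<Sum>(i, j) \<in> preds x y. card (paths_to i j))"
    by (rule sum.cong) (auto simp: R_def card_image inj_on_def)
  finally show ?thesis .
qed

section \<open>Counting by height above the diagonal\<close>

definition height_count :: "nat \<Rightarrow> nat \<Rightarrow> nat" where
  "height_count h x = card (paths_to x (x + h))"

text \<open>A step \<open>(b, c)\<close> with \<open>1 \<le> b \<le> c\<close> never lowers the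
  height, so it starts at some height \<open>k \<le> h\<close>; starting points below the diagonal
  contribute nothing.\<close>

lemma sum_diagonal_steps:
  "(\<Sum>(i, j) \<in> {(i, j). i < x \<and> j < x + h \<and> x + j \<le> x + h + i}. card (paths_to i j)) =
    (\<Sum>i<x. \<Sum>k<Suc h. height_count k i)"
proof -
  let ?A = "{(i, j). i < x \<and> j < x + h \<and> x + j \<le> x + h + i}"
  let ?B = "{(i, j). i < x \<and> i \<le> j \<and> j \<le> i + h}"
  have "finite ?A"
    by (rule finite_subset[of _ "{..<x} \<times> {..<x + h}"]) auto
  then have "(\<Sum>(i, j) \<in> ?A. card (paths_to i j)) = (\<Sum>(i, j) \<in> ?B. card (paths_to i j))"
    by (rule sum.mono_neutral_right) (auto simp: paths_to_empty intro: leI)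
  also have "\<dots> = (\<Sum>(i, k) \<in> {..<x} \<times> {..<Suc h}. height_count k i)"
    by (rule sum.reindex_bij_witness[of _ "\<lambda>(i, k). (i, i + k)" "\<lambda>(i, j). (i, j - i)"])
      (auto simp: height_count_def)
  finally show ?thesis
    by (simp only: sum.cartesian_product)
qed

text \<open>The three sums collect last steps that are horizontal (from a greater height), vertical
  (from a smaller one) and diagonal.\<close>

lemma height_count_rec:
  "height_count h x = of_bool (h = 0 \<and> x = 0) + (\<Sum>i<x. height_count (h + x - i) i)
    + (\<Sum>k<h. height_count k x) + (\<Sum>i<x. \<Sum>k<Suc h. height_count k i)"
proof -
  let ?N = "\<lambda>(i, j). card (paths_to i j)"
  let ?A = "(\<lambda>i. (i, x + h)) ` {..<x}" and ?B = "(\<lambda>j. (x, j)) ` {..<x + h}"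
  let ?C = "{(i, j). i < x \<and> j < x + h \<and> x + j \<le> x + h + i}"
  have preds: "preds x (x + h) = ?A \<union> ?B \<union> ?C"
    by (auto simp: preds_def step_set_iff)
  have fin: "finite ?C"
    by (rule finite_subset[of _ "{..<x} \<times> {..<x + h}"]) auto
  have "sum ?N (preds x (x + h)) = sum ?N ?A + sum ?N ?B + sum ?N ?C"
    unfolding preds using fin by (subst sum.union_disjoint; (subst sum.union_disjoint)?) auto
  moreover have "sum ?N ?A = (\<Sum>i<x. height_count (h + x - i) i)"
    by (simp add: sum.reindex inj_on_def height_count_def add.commute)
  moreover have "sum ?N ?B = (\<Sum>k<h. height_count k x)"
  proof -
    have "sum ?N ?B = (\<Sum>j<x + h. card (paths_to x j))"
      by (simp add: sum.reindex inj_on_def)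
    also have "\<dots> = (\<Sum>j\<in>{x..<x + h}. card (paths_to x j))"
      by (rule sum.mono_neutral_right) (auto simp: paths_to_empty)
    also have "\<dots> = (\<Sum>k<h. height_count k x)"
      by (rule sum.reindex_bij_witness[of _ "\<lambda>k. x + k" "\<lambda>j. j - x"])
        (auto simp: height_count_def)
    finally show ?thesis .
  qed
  moreover have "height_count h x = of_bool (h = 0 \<and> x = 0) + sum ?N (preds x (x + h))"
    unfolding height_count_def by (subst card_paths_to_rec) auto
  ultimately show ?thesis
    by (simp only: sum_diagonal_steps)
qed

section \<open>Generating functions and their recurrence\<close>

definition height_gf :: "nat \<Rightarrow> real fps" where
  "height_gf h = Abs_fps (\<lambda>x. real (height_count h x))"

definition partial_gf :: "nat \<Rightarrow> real fps" where
  "partial_gf h = (\<Sum>k<h. height_gf k)"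

lemma partial_gf_nth: "fps_nth (partial_gf h) x = (\<Sum>k<h. real (height_count k x))"
  by (simp add: partial_gf_def fps_sum_nth height_gf_def)

lemma partial_gf_recurrence:
  "fps_X * (2 - 3 * fps_X) * partial_gf (Suc (Suc h))
    - (1 + fps_X - 3 * fps_X\<^sup>2) * partial_gf (Suc h) + 2 * (1 - fps_X) * partial_gf h
    = - (1 - fps_X) * of_bool (h = 0)"
proof -
  define A where "A h = Abs_fps (\<lambda>x. \<Sum>i<x. real (height_count (h + x - i) i))" for h
  define D where "D h = Abs_fps (\<lambda>x. \<Sum>i<x. fps_nth (partial_gf (Suc h)) i)" for h
  have D: "(1 - fps_X) * D h = fps_X * partial_gf (Suc h)" for h
  proof (rule fps_ext)
    fix n show "fps_nth ((1 - fps_X) * D h) n = fps_nth (fps_X * partial_gf (Suc h)) n"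
      by (cases n) (simp_all add: D_def left_diff_distrib)
  qed
  \<comment> \<open>A last horizontal step has length 1, or is longer and gets shortened by 1; both
    cases lead to height \<open>h + 1\<close> one column to the left.\<close>
  have A: "A h = fps_X * (height_gf (Suc h) + A (Suc h))" for h
  proof (rule fps_ext)
    fix n show "fps_nth (A h) n = fps_nth (fps_X * (height_gf (Suc h) + A (Suc h))) n"
      by (cases n) (simp_all add: A_def height_gf_def)
  qed
  have g: "height_gf h = of_bool (h = 0) + A h + partial_gf h + D h" for h
  proof (rule fps_ext)
    fix n
    have "real (height_count h n) = of_bool (h = 0 \<and> n = 0)
        + (\<Sum>i<n. real (height_count (h + n - i) i)) + (\<Sum>k<h. real (height_count k n))
        + (\<Sum>i<n. \<Sum>k<Suc h. real (height_count k i))"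
      by (subst height_count_rec) simp
    then show "fps_nth (height_gf h) n = fps_nth (of_bool (h = 0) + A h + partial_gf h + D h) n"
      by (simp add: height_gf_def A_def D_def partial_gf_nth)
  qed
  have g_eq: "height_gf h = partial_gf (Suc h) - partial_gf h" for h
    by (simp add: partial_gf_def)
  have A_eq: "(1 - fps_X) * A h = (1 - 2 * fps_X) * partial_gf (Suc h)
      - 2 * (1 - fps_X) * partial_gf h - (1 - fps_X) * of_bool (h = 0)" for h
  proof -
    have "(1 - fps_X) * A h =
        (1 - fps_X) * (height_gf h - of_bool (h = 0) - partial_gf h) - (1 - fps_X) * D h"
      unfolding right_diff_distrib[symmetric] by (subst g[of h]) simp
    then show ?thesis
      unfolding D g_eq by (simp add: algebra_simps)
  qed
  \<comment> \<open>Inserting \<open>A_eq\<close> on both sides leaves a relation between partial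
    sums only.\<close>
  have "(1 - fps_X) * A h = fps_X * ((1 - fps_X) * height_gf (Suc h) + (1 - fps_X) * A (Suc h))"
    unfolding A[of h] by (simp add: algebra_simps)
  then show ?thesis
    unfolding A_eq g_eq by (simp add: algebra_simps power2_eq_square)
qed

text \<open>Iteration gives \<open>T 0 = U ^ n * T n\<close> for every \<open>n\<close>, so
  \<open>T 0\<close> is divisible by all powers of \<open>fps_X\<close>.\<close>

lemma fps_eq_0_if_geometric:
  fixes T :: "nat \<Rightarrow> 'a::idom fps"
  assumes "fps_nth U 0 = 0" and T: "\<And>h. T h = U * T (Suc h)"
  shows "T 0 = 0"
proof -
  have "T 0 = U ^ n * T n" for n
  proof (induction n)
    case (Suc n)
    then show ?case
      using T[of n] by (simp add: ac_simps)
  qed simp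
  moreover have "fps_nth (U ^ Suc n * f) n = 0" for n f
    using startsby_zero_power_prefix[OF assms(1)]
    by (subst fps_mult_nth) (simp del: power_Suc)
  ultimately show ?thesis
    by (intro fps_ext) (metis fps_zero_nth)
qed

lemma height_gf_0:
  fixes V :: "real fps"
  assumes V0: "fps_nth V 0 = 0"
    and V: "2 * V\<^sup>2 - (1 + fps_X - 3 * fps_X\<^sup>2) * V
      + (1 - fps_X) * (fps_X * (2 - 3 * fps_X)) = 0"
  shows "fps_X * (2 - 3 * fps_X) * height_gf 0 = V"
proof -
  define I :: "real fps" where "I = inverse (1 - fps_X)"
  have I: "I * (1 - fps_X) = 1"
    unfolding I_def by (rule inverse_mult_eq_1) simp
  define U where "U = V * I"
  define T where
    "T h = fps_X * (2 - 3 * fps_X) * partial_gf (Suc h) - 2 * V * partial_gf h" for h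
  have T: "T h = U * T (Suc h) + V * of_bool (h = 0)" for h
  proof -
    \<comment> \<open>This is \<open>V\<close> times the recurrence minus
      \<open>partial_gf (Suc h)\<close> times the quadratic for \<open>V\<close>.\<close>
    have "V * T (Suc h) - (1 - fps_X) * T h =
        V * (fps_X * (2 - 3 * fps_X) * partial_gf (Suc (Suc h))
          - (1 + fps_X - 3 * fps_X\<^sup>2) * partial_gf (Suc h) + 2 * (1 - fps_X) * partial_gf h)
        - partial_gf (Suc h) * (2 * V\<^sup>2 - (1 + fps_X - 3 * fps_X\<^sup>2) * V
          + (1 - fps_X) * (fps_X * (2 - 3 * fps_X)))"
      by (simp add: T_def algebra_simps power2_eq_square)
    then have "(1 - fps_X) * T h = V * T (Suc h) + (1 - fps_X) * V * of_bool (h = 0)"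
      unfolding V partial_gf_recurrence by (simp add: algebra_simps)
    then have "I * ((1 - fps_X) * T h) = I * (V * T (Suc h) + (1 - fps_X) * V * of_bool (h = 0))"
      by (rule arg_cong)
    then have "I * (1 - fps_X) * T h = U * T (Suc h) + I * (1 - fps_X) * V * of_bool (h = 0)"
      unfolding U_def distrib_left by (simp only: ac_simps)
    then show ?thesis
      by (simp only: I mult_1)
  qed
  \<comment> \<open>The index starts at 1 because the inhomogeneous term sits at
    \<open>h = 0\<close>.\<close>
  have "T (Suc 0) = 0"
  proof (rule fps_eq_0_if_geometric)
    show "fps_nth U 0 = 0"
      using V0 by (simp add: U_def)
    show "T (Suc h) = U * T (Suc (Suc h))" for h
      using T[of "Suc h"] by simp
  qed
  with T[of 0] have "T 0 = V"
    by simp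
  then show ?thesis
    by (simp add: T_def partial_gf_def)
qed

section \<open>Solving the quadratic equation\<close>

theorem theorem4p1:
  shows "catalan_gf step_set =
    (3 * fps_X ^ 2 - fps_X - 1 +
      fps_sqrt (1 - 14 * fps_X + 35 * fps_X ^ 2 - 30 * fps_X ^ 3 + 9 * fps_X ^ 4))
    / (4 * fps_X * (3 * fps_X - 2))"
proof -
  define \<Delta> :: "real fps"
    where "\<Delta> = 1 - 14 * fps_X + 35 * fps_X ^ 2 - 30 * fps_X ^ 3 + 9 * fps_X ^ 4"
  define s where "s = fps_sqrt \<Delta>"
  have "fps_nth \<Delta> 0 = 1"
    by (simp add: \<Delta>_def)
  then have s: "s ^ 2 = \<Delta>" "fps_nth s 0 = 1"
    using fps_sqrt_spec[of \<Delta>] by (simp_all add: s_def)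
  \<comment> \<open>\<open>\<Delta>\<close> is the discriminant of the quadratic; the minus sign
    before \<open>s\<close> selects the root with zero constant term.\<close>
  define V where "V = fps_const (1 / 4) * (1 + fps_X - 3 * fps_X\<^sup>2 - s)"
  have V4: "4 * V = 1 + fps_X - 3 * fps_X\<^sup>2 - s"
    by (simp add: V_def fps_numeral_fps_const flip: mult.assoc)
  have V0: "fps_nth V 0 = 0"
    using s(2) by (simp add: V_def)
  \<comment> \<open>The factor 8 completes the square in \<open>4 * V\<close>.\<close>
  have "8 * (2 * V\<^sup>2 - (1 + fps_X - 3 * fps_X\<^sup>2) * V
      + (1 - fps_X) * (fps_X * (2 - 3 * fps_X))) =
      (4 * V)\<^sup>2 - 2 * (1 + fps_X - 3 * fps_X\<^sup>2) * (4 * V)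
      + 8 * (1 - fps_X) * (fps_X * (2 - 3 * fps_X))"
    by (simp add: algebra_simps power2_eq_square)
  also have "\<dots> = s\<^sup>2 - \<Delta>"
    unfolding V4 \<Delta>_def
    by (simp add: algebra_simps power2_eq_square power3_eq_cube power4_eq_xxxx)
  finally have "8 * (2 * V\<^sup>2 - (1 + fps_X - 3 * fps_X\<^sup>2) * V
      + (1 - fps_X) * (fps_X * (2 - 3 * fps_X))) = 0"
    by (simp add: s(1))
  then have "2 * V\<^sup>2 - (1 + fps_X - 3 * fps_X\<^sup>2) * V
      + (1 - fps_X) * (fps_X * (2 - 3 * fps_X)) = 0"
    by (subst (asm) mult_eq_0_iff) simp
  note gf = height_gf_0[OF V0 this]
  have "catalan_gf step_set = height_gf 0"
    by (simp add: catalan_gf_def height_gf_def height_count_def catalan_paths_def paths_to_def)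
  then have "catalan_gf step_set * (4 * fps_X * (3 * fps_X - 2)) =
      - (4 * (fps_X * (2 - 3 * fps_X) * height_gf 0))"
    by (simp add: algebra_simps)
  then have *: "catalan_gf step_set * (4 * fps_X * (3 * fps_X - 2)) =
      3 * fps_X ^ 2 - fps_X - 1 + s"
    unfolding gf V4 by simp
  have "fps_nth (4 * fps_X * (3 * fps_X - 2) :: real fps) 1 = - 8"
    by (simp add: fps_numeral_fps_const mult.assoc)
  then have "4 * fps_X * (3 * fps_X - 2) \<noteq> (0 :: real fps)"
    by (metis fps_zero_nth neg_equal_0_iff_equal zero_neq_numeral)
  then show ?thesis
    unfolding \<Delta>_def[symmetric] s_def[symmetric] *[symmetric] by simp
qed

end
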